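(* Rendering a conservative and stable semidiscretisation of a scalar conservation law $\partial_tu+\partial_xf(u)=0$ fully discrete by using an explicit Euler step with modal filtering, $$\underline{u}\ \mapsto\ \tilde{\underline{u}}_+:=\underline{u}+\Delta t\,\partial_t\underline{u}\ \mapsto\ \underline{u}_+:=F\,\tilde{\underline{u}}_+,$$ yields a conservative and stable scheme if $$\|F\tilde{\underline{u}}_+\|_M^2=\|\underline{u}\|_M^2+2\Delta t\,\langle\underline{u},\partial_t\underline{u}\rangle_M\ \le\ \|\tilde{\underline{u}}_+\|_M^2=\|\underline{u}\|_M^2+2\Delta t\,\langle\underline{u},\partial_t\underline{u}\rangle_M+(\Delta t)^2\|\partial_t\underline{u}\|_M^2. \qquad ( * )$$ Condition $( * )$ can be fulfilled (per element, by adapting the filter strength) if - the rate of change $\partial_t\underline{u}$ is zero, or - the intermediate value $\tilde{\underline{u}}_+$ is not constant and the time step $\Delta t$ is small enough.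
   Context: Setting. A one-dimensional scalar conservation law on an interval with periodic boundary conditions. The interval is partitioned into elements, each mapped onto the reference element $[-1,1]$, where all computations are done. On each element the numerical solution is a polynomial of degree $\le p$, represented by its coefficient vector $\underline{u}$ with respect to a nodal Lagrange basis (at Gauss-Legendre or Lobatto-Legendre nodes) or a modal Legendre basis. $M$ is the mass matrix representing a scalar product that approximates the $L_2$ scalar product; $\langle\underline{u},\underline{v}\rangle_M=\underline{u}^TM\underline{v}$ and $\|\underline{u}\|_M^2=\langle\underline{u},\underline{u}\rangle_M$. $\partial_t\underline{u}$ is the time derivative given by the semidiscretisation and $\Delta t>0$ is the time step. Modal filter. In the modal basis of Legendre polynomials $\phi_0,\dots,\phi_p$, the (exact) modal filter of order $s\in\mathbb{N}$ and strength $\epsilon\ge0$ is $F=\mathrm{diag}\big(\exp(-\epsilon\,\lambda_n^s\,\Delta t)\big)_{n=0}^p$ with $\lambda_n=n(n+1)$. The strength $\epsilon$ may be adapted on each element. Notions. Conservative means that the total integral of the numerical solution is preserved. The semidiscretisation is stable in the sense that $\langle\underline{u},\partial_t\underline{u}\rangle_M$ reduces to boundary terms which, by the choice of numerical flux, contribute non-positively to the rate of change of the total discrete squared norm. Stability of the fully discrete scheme means that it allows the same estimate as the semidiscretisation, i.e. the squared norm after one step is bounded by $\|\underline{u}\|_M^2+2\Delta t\,\langle\underline{u},\partial_t\underline{u}\rangle_M$ (per element). *)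

theory Defs
  imports
    "HOL-Analysis.Analysis"
    "HOL-Computational_Algebra.Polynomial"
    "Jordan_Normal_Form.Matrix"
begin

unbundle no vec_syntax
hide_type (open) Finite_Cartesian_Product.vec

text \<open>Rodrigues' formula.\<close>

definition legendre :: "nat \<Rightarrow> real poly" where
  "legendre n = Polynomial.smult (1 / (2 ^ n * fact n)) ((pderiv ^^ n) ([:-1, 0, 1:] ^ n))"

definition ref_integral :: "real poly \<Rightarrow> real" where
  "ref_integral q = integral {-1..1} (poly q)"

definition lagrange :: "nat \<Rightarrow> (nat \<Rightarrow> real) \<Rightarrow> nat \<Rightarrow> real poly" where
  "lagrange p \<xi> i = (\<Prod>j\<in>{..p} - {i}. Polynomial.smult (1 / (\<xi> i - \<xi> j)) [:- \<xi> j, 1:])"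

definition gauss_nodes :: "nat \<Rightarrow> (nat \<Rightarrow> real) \<Rightarrow> bool" where
  "gauss_nodes p \<xi> \<longleftrightarrow>
     strict_mono_on {..p} \<xi> \<and> \<xi> ` {..p} = {z. poly (legendre (Suc p)) z = 0}"

definition lobatto_nodes :: "nat \<Rightarrow> (nat \<Rightarrow> real) \<Rightarrow> bool" where
  "lobatto_nodes p \<xi> \<longleftrightarrow> p \<ge> 1 \<and>
     strict_mono_on {..p} \<xi> \<and> \<xi> ` {..p} = {-1, 1} \<union> {z. poly (pderiv (legendre p)) z = 0}"

definition L2_product :: "real poly \<Rightarrow> real poly \<Rightarrow> real" where
  "L2_product q r = ref_integral (q * r)"

definition quadrature_product :: "nat \<Rightarrow> (nat \<Rightarrow> real) \<Rightarrow> real poly \<Rightarrow> real poly \<Rightarrow> real" where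
  "quadrature_product p \<xi> q r =
     (\<Sum>i\<le>p. ref_integral (lagrange p \<xi> i) * poly q (\<xi> i) * poly r (\<xi> i))"

text \<open>Bases and scalar products may be combined freely.  A nodal basis with the quadrature at its
  own nodes gives the usual diagonal mass matrix of the quadrature weights.\<close>

definition admissible_basis :: "nat \<Rightarrow> (nat \<Rightarrow> real poly) \<Rightarrow> bool" where
  "admissible_basis p b \<longleftrightarrow>
     (\<exists>\<xi>. (gauss_nodes p \<xi> \<or> lobatto_nodes p \<xi>) \<and> b = lagrange p \<xi>) \<or> b = legendre"

definition admissible_product :: "nat \<Rightarrow> (real poly \<Rightarrow> real poly \<Rightarrow> real) \<Rightarrow> bool" where
  "admissible_product p S \<longleftrightarrow>
     S = L2_product \<or>
     (\<exists>\<xi>. (gauss_nodes p \<xi> \<or> lobatto_nodes p \<xi>) \<and> S = quadrature_product p \<xi>)"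

definition mass_matrix ::
  "nat \<Rightarrow> (nat \<Rightarrow> real poly) \<Rightarrow> (real poly \<Rightarrow> real poly \<Rightarrow> real) \<Rightarrow> real mat" where
  "mass_matrix p b S = Matrix.mat (Suc p) (Suc p) (\<lambda>(i, j). S (b i) (b j))"

definition inner_M :: "real mat \<Rightarrow> real Matrix.vec \<Rightarrow> real Matrix.vec \<Rightarrow> real" where
  "inner_M M u v = u \<bullet> (M *\<^sub>v v)"

definition sqnorm_M :: "real mat \<Rightarrow> real Matrix.vec \<Rightarrow> real" where
  "sqnorm_M M u = inner_M M u u"

definition poly_of :: "nat \<Rightarrow> (nat \<Rightarrow> real poly) \<Rightarrow> real Matrix.vec \<Rightarrow> real poly" where
  "poly_of p b u = (\<Sum>i\<le>p. Polynomial.smult (u $ i) (b i))"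

definition constant_on_element :: "nat \<Rightarrow> (nat \<Rightarrow> real poly) \<Rightarrow> real Matrix.vec \<Rightarrow> bool" where
  "constant_on_element p b u \<longleftrightarrow> (\<exists>c. poly_of p b u = [:c:])"

definition coords :: "nat \<Rightarrow> (nat \<Rightarrow> real poly) \<Rightarrow> real poly \<Rightarrow> real Matrix.vec" where
  "coords p b q = (THE c. c \<in> carrier_vec (Suc p) \<and> poly_of p b c = q)"

text \<open>Maps coefficients with respect to \<open>b\<close> to coefficients with respect to \<open>c\<close>.\<close>

definition basis_change :: "nat \<Rightarrow> (nat \<Rightarrow> real poly) \<Rightarrow> (nat \<Rightarrow> real poly) \<Rightarrow> real mat" where
  "basis_change p b c = Matrix.mat (Suc p) (Suc p) (\<lambda>(i, j). coords p c (b j) $ i)"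

definition modal_filter :: "nat \<Rightarrow> nat \<Rightarrow> real \<Rightarrow> real \<Rightarrow> real mat" where
  "modal_filter p s \<epsilon> \<Delta>t =
     mat_diag (Suc p) (\<lambda>n. exp (- \<epsilon> * (real n * (real n + 1)) ^ s * \<Delta>t))"

definition filter_matrix ::
  "nat \<Rightarrow> (nat \<Rightarrow> real poly) \<Rightarrow> nat \<Rightarrow> real \<Rightarrow> real \<Rightarrow> real mat" where
  "filter_matrix p b s \<epsilon> \<Delta>t =
     basis_change p legendre b * modal_filter p s \<epsilon> \<Delta>t * basis_change p b legendre"

definition euler :: "real \<Rightarrow> real Matrix.vec \<Rightarrow> real Matrix.vec \<Rightarrow> real Matrix.vec" where
  "euler \<Delta>t u dudt = u + \<Delta>t \<cdot>\<^sub>v dudt"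

definition filter_condition ::
  "nat \<Rightarrow> (nat \<Rightarrow> real poly) \<Rightarrow> real mat \<Rightarrow> nat \<Rightarrow> real \<Rightarrow> real \<Rightarrow>
   real Matrix.vec \<Rightarrow> real Matrix.vec \<Rightarrow> bool" where
  "filter_condition p b M s \<epsilon> \<Delta>t u dudt \<longleftrightarrow>
     sqnorm_M M (filter_matrix p b s \<epsilon> \<Delta>t *\<^sub>v euler \<Delta>t u dudt)
       = sqnorm_M M u + 2 * \<Delta>t * inner_M M u dudt \<and>
     sqnorm_M M u + 2 * \<Delta>t * inner_M M u dudt \<le> sqnorm_M M (euler \<Delta>t u dudt) \<and>
     sqnorm_M M (euler \<Delta>t u dudt)
       = sqnorm_M M u + 2 * \<Delta>t * inner_M M u dudt + \<Delta>t\<^sup>2 * sqnorm_M M dudt"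

text \<open>The elements are the intervals from \<open>X i\<close> to \<open>X (Suc i)\<close> with \<open>i < N\<close>.  A state assigns to
  each of them its coefficient vector; values at indices \<open>i \<ge> N\<close> are irrelevant.\<close>

type_synonym state = "nat \<Rightarrow> real Matrix.vec"

definition mesh :: "nat \<Rightarrow> (nat \<Rightarrow> real) \<Rightarrow> bool" where
  "mesh N X \<longleftrightarrow> N \<ge> 1 \<and> strict_mono_on {..N} X"

definition states :: "nat \<Rightarrow> nat \<Rightarrow> state set" where
  "states N p = {U. \<forall>i<N. U i \<in> carrier_vec (Suc p)}"

text \<open>Jacobian of the affine map from the reference element \<open>[-1, 1]\<close> to element \<open>i\<close>.\<close>

definition jac :: "(nat \<Rightarrow> real) \<Rightarrow> nat \<Rightarrow> real" where
  "jac X i = (X (Suc i) - X i) / 2"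

definition total_integral ::
  "nat \<Rightarrow> (nat \<Rightarrow> real) \<Rightarrow> nat \<Rightarrow> (nat \<Rightarrow> real poly) \<Rightarrow> state \<Rightarrow> real" where
  "total_integral N X p b U = (\<Sum>i<N. jac X i * ref_integral (poly_of p b (U i)))"

definition total_sqnorm :: "nat \<Rightarrow> (nat \<Rightarrow> real) \<Rightarrow> real mat \<Rightarrow> state \<Rightarrow> real" where
  "total_sqnorm N X M U = (\<Sum>i<N. jac X i * sqnorm_M M (U i))"

definition left_value :: "nat \<Rightarrow> (nat \<Rightarrow> real poly) \<Rightarrow> state \<Rightarrow> nat \<Rightarrow> real" where
  "left_value p b U i = poly (poly_of p b (U i)) (-1)"

definition right_value :: "nat \<Rightarrow> (nat \<Rightarrow> real poly) \<Rightarrow> state \<Rightarrow> nat \<Rightarrow> real" where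
  "right_value p b U i = poly (poly_of p b (U i)) 1"

definition right_flux ::
  "(real \<Rightarrow> real \<Rightarrow> real) \<Rightarrow> nat \<Rightarrow> nat \<Rightarrow> (nat \<Rightarrow> real poly) \<Rightarrow> state \<Rightarrow> nat \<Rightarrow> real" where
  "right_flux g N p b U i = g (right_value p b U i) (left_value p b U ((i + 1) mod N))"

definition left_flux ::
  "(real \<Rightarrow> real \<Rightarrow> real) \<Rightarrow> nat \<Rightarrow> nat \<Rightarrow> (nat \<Rightarrow> real poly) \<Rightarrow> state \<Rightarrow> nat \<Rightarrow> real" where
  "left_flux g N p b U i = g (right_value p b U ((i + N - 1) mod N)) (left_value p b U i)"

text \<open>\<open>rate\<close> maps a state to its time derivative.  As usual for discontinuous elements, the rate of
  change on an element depends on the solution there and, through a numerical flux \<open>g\<close> consistent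
  with the flux \<open>f\<close> of the conservation law, on its neighbours.  The discretisation of the volume
  terms (strong, weak or split form, correction terms) is left open as \<open>\<Phi>\<close>.\<close>

definition semidiscretisation ::
  "(real \<Rightarrow> real) \<Rightarrow> (real \<Rightarrow> real \<Rightarrow> real) \<Rightarrow> nat \<Rightarrow> nat \<Rightarrow> (nat \<Rightarrow> real poly) \<Rightarrow>
   (state \<Rightarrow> state) \<Rightarrow> bool" where
  "semidiscretisation f g N p b rate \<longleftrightarrow>
     (\<forall>a. g a a = f a) \<and>
     (\<forall>U\<in>states N p. rate U \<in> states N p) \<and>
     (\<forall>i<N. \<exists>\<Phi>. \<forall>U\<in>states N p.
        rate U i = \<Phi> (U i) (left_flux g N p b U i) (right_flux g N p b U i))"

definition conservative_semidiscretisation ::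
  "nat \<Rightarrow> (nat \<Rightarrow> real) \<Rightarrow> nat \<Rightarrow> (nat \<Rightarrow> real poly) \<Rightarrow> (state \<Rightarrow> state) \<Rightarrow> bool" where
  "conservative_semidiscretisation N X p b rate \<longleftrightarrow>
     (\<forall>U\<in>states N p. total_integral N X p b (rate U) = 0)"

text \<open>\<open>\<beta>l\<close> and \<open>\<beta>r\<close> are the boundary terms at the left and right end of an element, functions of
  the inner trace and the numerical flux.  At an interface with traces \<open>a\<close> (left) and \<open>c\<close> (right),
  the right boundary term of one element meets the left boundary term of the next.  Standard
  example: \<open>\<beta>r a \<phi> = \<psi> a - a * \<phi>\<close> and \<open>\<beta>l c \<phi> = c * \<phi> - \<psi> c\<close> with \<open>\<psi>\<close> a primitive of \<open>f\<close>.\<close>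

definition stable_semidiscretisation ::
  "(real \<Rightarrow> real \<Rightarrow> real) \<Rightarrow> nat \<Rightarrow> (nat \<Rightarrow> real) \<Rightarrow> nat \<Rightarrow> (nat \<Rightarrow> real poly) \<Rightarrow> real mat \<Rightarrow>
   (state \<Rightarrow> state) \<Rightarrow> bool" where
  "stable_semidiscretisation g N X p b M rate \<longleftrightarrow>
     (\<exists>\<beta>l \<beta>r.
        (\<forall>U\<in>states N p. \<forall>i<N.
           jac X i * inner_M M (U i) (rate U i) =
             \<beta>l (left_value p b U i) (left_flux g N p b U i) +
             \<beta>r (right_value p b U i) (right_flux g N p b U i)) \<and>
        (\<forall>a c. \<beta>r a (g a c) + \<beta>l c (g a c) \<le> 0))"

definition filtered_euler ::
  "nat \<Rightarrow> (nat \<Rightarrow> real poly) \<Rightarrow> nat \<Rightarrow> (nat \<Rightarrow> real) \<Rightarrow> real \<Rightarrow> (state \<Rightarrow> state) \<Rightarrow> state \<Rightarrow> state" where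
  "filtered_euler p b s \<epsilon> \<Delta>t rate U =
     (\<lambda>i. filter_matrix p b s (\<epsilon> i) \<Delta>t *\<^sub>v euler \<Delta>t (U i) (rate U i))"

definition conservative_step ::
  "nat \<Rightarrow> (nat \<Rightarrow> real) \<Rightarrow> nat \<Rightarrow> (nat \<Rightarrow> real poly) \<Rightarrow> state \<Rightarrow> state \<Rightarrow> bool" where
  "conservative_step N X p b U U' \<longleftrightarrow> total_integral N X p b U' = total_integral N X p b U"

definition stable_step ::
  "nat \<Rightarrow> real mat \<Rightarrow> real \<Rightarrow> (state \<Rightarrow> state) \<Rightarrow> state \<Rightarrow> state \<Rightarrow> bool" where
  "stable_step N M \<Delta>t rate U U' \<longleftrightarrow>
     (\<forall>i<N. sqnorm_M M (U' i) \<le> sqnorm_M M (U i) + 2 * \<Delta>t * inner_M M (U i) (rate U i))"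

end

theory Submission
  imports Defs
begin

text \<open>Every admissible scalar product is positive definite on polynomials of degree at most \<open>p\<close> and
  agrees with the \<open>L\<^sub>2\<close> product when one argument is constant.  For the quadratures this needs the
  positivity of the weights, which follows from testing the quadrature, exact up to degree \<open>2 p + 1\<close>
  (Gauss) or \<open>2 p - 1\<close> (Lobatto), with nonnegative polynomials vanishing at all nodes but one.
  Hence constants are orthogonal to the higher Legendre polynomials.  The filter preserves the mean
  value, and as its strength grows from \<open>0\<close> to infinity, the squared norm of the filtered value moves
  continuously from that of the intermediate value to that of its mean.  By the intermediate value
  theorem it attains the required value as soon as \<open>\<Delta>t\<^sup>2\<close> times the squared norm of the rate of
  change is below the squared distance of the intermediate value from its mean, which is positive
  for a non-constant value.\<close>

section \<open>Integration of polynomials over the reference element\<close>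

lemma poly_integrable: "poly (q :: real poly) integrable_on {-1..1}"
  by (intro integrable_continuous_interval continuous_intros)

lemma ref_integral_add: "ref_integral (q + r) = ref_integral q + ref_integral r"
proof -
  have "poly (q + r) = (\<lambda>x. poly q x + poly r x)" by (rule ext) simp
  then show ?thesis
    unfolding ref_integral_def by (simp add: integral_add poly_integrable)
qed

lemma ref_integral_smult: "ref_integral (Polynomial.smult c q) = c * ref_integral q"
proof -
  have "poly (Polynomial.smult c q) = (\<lambda>x. c * poly q x)" by (rule ext) simp
  then show ?thesis by (simp add: ref_integral_def)
qed

lemma ref_integral_0 [simp]: "ref_integral 0 = 0"
  using ref_integral_smult[of 0 0] by simp

lemma ref_integral_1: "ref_integral 1 = 2"
proof -
  have "poly 1 = (\<lambda>x :: real. 1 :: real)" by (rule ext) simp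
  then show ?thesis by (simp add: ref_integral_def)
qed

lemma ref_integral_sum: "ref_integral (\<Sum>i\<in>A. q i) = (\<Sum>i\<in>A. ref_integral (q i))"
  by (induction A rule: infinite_finite_induct) (auto simp: ref_integral_add)

lemma ref_integral_pderiv: "ref_integral (pderiv q) = poly q 1 - poly q (-1)"
proof -
  have "(poly (pderiv q) has_integral poly q 1 - poly q (-1)) {-1..1}"
    by (rule fundamental_theorem_of_calculus)
      (auto intro: DERIV_subset[OF poly_DERIV]
        simp: has_real_derivative_iff_has_vector_derivative[symmetric])
  then show ?thesis
    by (simp add: ref_integral_def integral_unique)
qed

lemma ref_integral_by_parts:
  assumes "poly (q * r) 1 = 0" "poly (q * r) (-1) = 0"
  shows "ref_integral (pderiv q * r) = - ref_integral (q * pderiv r)"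
proof -
  have "ref_integral (pderiv (q * r)) = 0"
    using assms by (simp only: ref_integral_pderiv diff_self)
  then have "ref_integral (q * pderiv r) + ref_integral (pderiv q * r) = 0"
    by (simp add: pderiv_mult ref_integral_add mult.commute)
  then show ?thesis by simp
qed

text \<open>A continuous nonnegative function with zero integral vanishes on the whole interval,
  whereas a nonzero polynomial has only finitely many roots.\<close>

lemma ref_integral_pos:
  assumes "q \<noteq> 0" "\<And>x. -1 \<le> x \<Longrightarrow> x \<le> 1 \<Longrightarrow> 0 \<le> poly q x"
  shows "0 < ref_integral q"
proof -
  have cont: "continuous_on {-1..1} (poly q)" by (intro continuous_intros)
  have "0 \<le> ref_integral q"
    unfolding ref_integral_def using assms(2) by (intro integral_nonneg poly_integrable) auto
  moreover have "ref_integral q \<noteq> 0"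
  proof
    assume "ref_integral q = 0"
    then have "\<forall>x\<in>{-1..1}. poly q x = 0"
      unfolding ref_integral_def using integral_eq_0_iff[OF cont] assms(2) by auto
    then have "{-1..1} \<subseteq> {x. poly q x = 0}" by auto
    with poly_roots_finite[OF assms(1)] have "finite {-1..1::real}"
      using finite_subset by blast
    then show False
      using infinite_Icc[of "-1::real" 1] by simp
  qed
  ultimately show ?thesis by simp
qed

lemma ref_integral_square_pos: "q \<noteq> 0 \<Longrightarrow> 0 < ref_integral (q * q)"
  by (rule ref_integral_pos) auto

section \<open>Legendre polynomials\<close>

lemma power_dvd_pderiv:
  fixes q h :: "real poly"
  assumes "q ^ Suc n dvd h"
  shows "q ^ n dvd pderiv h"
proof -
  obtain k where "h = q ^ Suc n * k" using assms by (auto simp: dvd_def)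
  then have "pderiv h = q ^ n * (q * pderiv k + k * Polynomial.smult (of_nat (Suc n)) (pderiv q))"
    by (simp only: pderiv_mult pderiv_power_Suc) (simp add: algebra_simps)
  then show ?thesis by simp
qed

text \<open>Each differentiation lowers the multiplicity of the factor \<open>q\<close> by at most
  one.\<close>

lemma power_dvd_higher_pderiv:
  fixes q h :: "real poly"
  shows "q ^ (n + k) dvd h \<Longrightarrow> q ^ n dvd (pderiv ^^ k) h"
  by (induction k arbitrary: n) (auto intro!: power_dvd_pderiv simp flip: add_Suc)

text \<open>Integrating by parts \<open>k\<close> times moves all derivatives onto \<open>q\<close>.
  The boundary terms vanish because every derivative of \<open>h\<close> of order below
  \<open>k\<close> keeps a factor x^2 - 1. In the induction \<open>h\<close> stays fixed while
  \<open>q\<close> is replaced by its derivative.\<close>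

lemma ref_integral_higher_pderiv_eq_0:
  fixes h q :: "real poly"
  assumes "[:-1, 0, 1:] ^ k dvd h" "(pderiv ^^ k) q = 0"
  shows "ref_integral ((pderiv ^^ k) h * q) = 0"
  using assms
proof (induction k arbitrary: q)
  case 0
  then show ?case by simp
next
  case (Suc k)
  have "[:-1, 0, 1:] ^ 1 dvd (pderiv ^^ k) h"
    using Suc.prems(1) by (intro power_dvd_higher_pderiv) simp
  then obtain r where "(pderiv ^^ k) h = [:-1, 0, 1:] * r" by (auto simp only: dvd_def power_one_right)
  then have "poly ((pderiv ^^ k) h * q) 1 = 0" "poly ((pderiv ^^ k) h * q) (-1) = 0"
    by simp_all
  then have "ref_integral (pderiv ((pderiv ^^ k) h) * q) = - ref_integral ((pderiv ^^ k) h * pderiv q)"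
    by (rule ref_integral_by_parts)
  also have "\<dots> = 0"
  proof -
    have "[:-1, 0, 1:] ^ k dvd h"
      using Suc.prems(1) by (rule power_le_dvd) simp
    moreover have "(pderiv ^^ k) (pderiv q) = 0"
      using Suc.prems(2) by (simp add: funpow_swap1)
    ultimately show ?thesis using Suc.IH by simp
  qed
  finally show ?case by simp
qed

lemma legendre_0 [simp]: "legendre 0 = 1"
  by (simp add: legendre_def)

lemma degree_legendre: "degree (legendre n) = n"
  by (simp add: legendre_def degree_higher_pderiv degree_power_eq)

lemma legendre_nonzero: "legendre n \<noteq> 0"
  by (metis degree_0 degree_legendre legendre_0 zero_neq_one)

lemma higher_pderiv_eq_0: "degree (q :: real poly) < n \<Longrightarrow> (pderiv ^^ n) q = 0"
  by (cases n) (auto simp: pderiv_eq_0_iff degree_higher_pderiv)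

text \<open>Rodrigues' formula makes this the case h = (x^2 - 1)^n of
  \<open>ref_integral_higher_pderiv_eq_0\<close>.\<close>

lemma legendre_orthogonal:
  assumes "degree q < n"
  shows "ref_integral (legendre n * q) = 0"
  using ref_integral_higher_pderiv_eq_0[OF dvd_refl higher_pderiv_eq_0[OF assms]]
  by (simp add: legendre_def ref_integral_smult)

lemma legendre_orthogonal':
  assumes "m \<noteq> n"
  shows "ref_integral (legendre m * legendre n) = 0"
  using assms legendre_orthogonal[of "legendre m" n] legendre_orthogonal[of "legendre n" m]
  by (cases "m < n") (auto simp: degree_legendre mult.commute)

lemma ref_integral_legendre: "ref_integral (legendre n) = (if n = 0 then 2 else 0)"
  using legendre_orthogonal[of 1 n] by (auto simp: ref_integral_1)

section \<open>Bases and coordinates\<close>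

text \<open>Interface through which nodal and modal bases are treated alike. Existence and
  uniqueness of the coefficients make the definite description in \<open>coords\<close>
  meaningful.\<close>

definition poly_basis :: "nat \<Rightarrow> (nat \<Rightarrow> real poly) \<Rightarrow> bool" where
  "poly_basis p b \<longleftrightarrow> (\<forall>i\<le>p. degree (b i) \<le> p) \<and>
     (\<forall>q. degree q \<le> p \<longrightarrow> (\<exists>!c. c \<in> carrier_vec (Suc p) \<and> poly_of p b c = q))"

lemma poly_basis_degree: "poly_basis p b \<Longrightarrow> i \<le> p \<Longrightarrow> degree (b i) \<le> p"
  by (simp add: poly_basis_def)

lemma poly_of_coords:
  assumes "poly_basis p b" "degree q \<le> p"
  shows "poly_of p b (coords p b q) = q"
proof -
  have "\<exists>!c. c \<in> carrier_vec (Suc p) \<and> poly_of p b c = q"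
    using assms by (simp add: poly_basis_def)
  from theI'[OF this] show ?thesis by (simp add: coords_def)
qed

lemma degree_poly_of:
  assumes "poly_basis p b"
  shows "degree (poly_of p b u) \<le> p"
  unfolding poly_of_def using assms
  by (intro degree_sum_le) (auto intro: order_trans[OF degree_smult_le] poly_basis_degree)

lemma smult_sum_distrib:
  "Polynomial.smult c (\<Sum>i\<in>A. q i) = (\<Sum>i\<in>A. Polynomial.smult c (q i))"
  by (induction A rule: infinite_finite_induct) (auto simp: smult_add_right)

lemma poly_of_euler:
  assumes "u \<in> carrier_vec (Suc p)" "v \<in> carrier_vec (Suc p)"
  shows "poly_of p b (euler t u v) = poly_of p b u + Polynomial.smult t (poly_of p b v)"
  using assms unfolding poly_of_def euler_def
  by (simp add: smult_add_left sum.distrib smult_sum_distrib)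

text \<open>Column \<open>j\<close> of the matrix holds the coordinates of \<open>b j\<close> with
  respect to \<open>c\<close>, so exchanging the two sums reassembles the original
  polynomial.\<close>

lemma poly_of_basis_change:
  assumes "\<And>j. j \<le> p \<Longrightarrow> degree (b j) \<le> p" "poly_basis p c" "w \<in> carrier_vec (Suc p)"
  shows "poly_of p c (basis_change p b c *\<^sub>v w) = poly_of p b w"
proof -
  have "(basis_change p b c *\<^sub>v w) $ i = (\<Sum>j\<le>p. coords p c (b j) $ i * w $ j)" if "i \<le> p" for i
    using that assms(3)
    by (simp add: basis_change_def scalar_prod_def atLeast0LessThan lessThan_Suc_atMost)
  then have "poly_of p c (basis_change p b c *\<^sub>v w)
      = (\<Sum>i\<le>p. \<Sum>j\<le>p. Polynomial.smult (w $ j) (Polynomial.smult (coords p c (b j) $ i) (c i)))"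
    by (simp add: poly_of_def smult_sum mult.commute)
  also have "\<dots> = (\<Sum>j\<le>p. Polynomial.smult (w $ j) (poly_of p c (coords p c (b j))))"
    by (subst sum.swap) (simp add: poly_of_def smult_sum_distrib)
  also have "\<dots> = poly_of p b w"
    using assms unfolding poly_of_def[of p b] by (intro sum.cong) (simp_all add: poly_of_coords)
  finally show ?thesis .
qed

lemma ref_integral_poly_of_legendre: "ref_integral (poly_of p legendre a) = 2 * a $ 0"
  by (simp add: poly_of_def ref_integral_sum ref_integral_smult ref_integral_legendre
      if_distrib[of "(*) _"] cong: if_cong)

lemma legendre_expansion:
  "degree q \<le> p \<Longrightarrow> \<exists>c. q = (\<Sum>i\<le>p. Polynomial.smult (c i) (legendre i))"
proof (induction p arbitrary: q)
  case 0
  then obtain c where "q = [:c:]" by (auto elim: degree_eq_zeroE)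
  then show ?case by (intro exI[of _ "\<lambda>_. c"]) (simp add: one_pCons)
next
  case (Suc p)
  \<comment> \<open>The multiple of the top Legendre polynomial that cancels the coefficient of
    degree \<open>Suc p\<close>, so that the induction hypothesis applies to the difference.\<close>
  define k where "k = coeff q (Suc p) / coeff (legendre (Suc p)) (Suc p)"
  have lc: "coeff (legendre (Suc p)) (Suc p) \<noteq> 0"
    using legendre_nonzero[of "Suc p"] degree_legendre[of "Suc p"] leading_coeff_neq_0 by metis
  have "degree (q - Polynomial.smult k (legendre (Suc p))) \<le> p"
  proof (rule degree_le, intro allI impI)
    fix i assume "p < i"
    show "coeff (q - Polynomial.smult k (legendre (Suc p))) i = 0"
    proof (cases "i = Suc p")
      case True
      then show ?thesis using lc by (simp add: k_def)
    next
      case False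
      with \<open>p < i\<close> Suc.prems degree_legendre[of "Suc p"] show ?thesis
        by (simp add: coeff_eq_0)
    qed
  qed
  from Suc.IH[OF this] obtain c where
    c: "q - Polynomial.smult k (legendre (Suc p)) = (\<Sum>i\<le>p. Polynomial.smult (c i) (legendre i))"
    by blast
  have "(\<Sum>i\<le>p. Polynomial.smult ((c(Suc p := k)) i) (legendre i))
      = (\<Sum>i\<le>p. Polynomial.smult (c i) (legendre i))"
    by (intro sum.cong) auto
  then have "q = (\<Sum>i\<le>Suc p. Polynomial.smult ((c(Suc p := k)) i) (legendre i))"
    using c by (simp add: algebra_simps)
  then show ?case by blast
qed

text \<open>Orthogonality isolates a single coefficient. As the squared norms are positive, this
  yields uniqueness of the Legendre expansion.\<close>

lemma legendre_coefficient:
  assumes "i \<le> p"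
  shows "ref_integral (poly_of p legendre a * legendre i)
    = a $ i * ref_integral (legendre i * legendre i)"
proof -
  have "ref_integral (poly_of p legendre a * legendre i)
      = (\<Sum>j\<le>p. a $ j * ref_integral (legendre j * legendre i))"
    by (simp add: poly_of_def sum_distrib_right ref_integral_sum ref_integral_smult)
  also have "\<dots> = (\<Sum>j\<le>p. if j = i then a $ i * ref_integral (legendre i * legendre i) else 0)"
    by (intro sum.cong) (auto simp: legendre_orthogonal')
  finally show ?thesis using assms by simp
qed

lemma poly_basis_legendre: "poly_basis p legendre"
  unfolding poly_basis_def
proof (intro conjI allI impI ex_ex1I)
  fix q :: "real poly" assume "degree q \<le> p"
  from legendre_expansion[OF this] obtain c
    where c: "q = (\<Sum>i\<le>p. Polynomial.smult (c i) (legendre i))" ..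
  show "\<exists>c. c \<in> carrier_vec (Suc p) \<and> poly_of p legendre c = q"
    by (rule exI[of _ "Matrix.vec (Suc p) c"]) (simp add: poly_of_def c)
next
  fix q c d
  assume c: "c \<in> carrier_vec (Suc p) \<and> poly_of p legendre c = q"
    and d: "d \<in> carrier_vec (Suc p) \<and> poly_of p legendre d = q"
  have "c $ i = d $ i" if "i \<le> p" for i
    using legendre_coefficient[OF that, of c] legendre_coefficient[OF that, of d] c d
      ref_integral_square_pos[OF legendre_nonzero, of i] by simp
  with c d show "c = d" by (intro eq_vecI) auto
qed (simp add: degree_legendre)

section \<open>Quadrature at the nodes\<close>

lemma poly_lagrange:
  assumes "inj_on \<xi> {..p}" "i \<le> p" "j \<le> p"
  shows "poly (lagrange p \<xi> i) (\<xi> j) = (if i = j then 1 else 0)"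
proof (cases "i = j")
  case True
  have "\<xi> i - \<xi> k \<noteq> 0" if "k \<in> {..p} - {i}" for k
    using assms that by (auto dest: inj_onD)
  then have "poly (Polynomial.smult (1 / (\<xi> i - \<xi> k)) [:- \<xi> k, 1:]) (\<xi> i) = 1"
    if "k \<in> {..p} - {i}" for k using that by (simp add: divide_simps)
  with True show ?thesis
    unfolding lagrange_def poly_prod by (auto intro: prod.neutral)
next
  case False
  then have "\<exists>k\<in>{..p} - {i}. poly (Polynomial.smult (1 / (\<xi> i - \<xi> k)) [:- \<xi> k, 1:]) (\<xi> j) = 0"
    using assms by (intro bexI[of _ j]) auto
  with False show ?thesis
    by (simp add: lagrange_def poly_prod prod_zero_iff)
qed

lemma degree_lagrange:
  assumes "i \<le> p"
  shows "degree (lagrange p \<xi> i) \<le> p"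
proof -
  have "degree (lagrange p \<xi> i)
      \<le> sum (degree \<circ> (\<lambda>j. Polynomial.smult (1 / (\<xi> i - \<xi> j)) [:- \<xi> j, 1:])) ({..p} - {i})"
    unfolding lagrange_def by (rule degree_prod_sum_le) simp
  also have "\<dots> \<le> (\<Sum>j\<in>{..p} - {i}. 1)"
    by (rule sum_mono) auto
  also have "\<dots> = p" using assms by simp
  finally show ?thesis .
qed

lemma poly_eq_at_nodes:
  assumes "inj_on \<xi> {..p}" "degree q \<le> p" "degree r \<le> p" "\<And>i. i \<le> p \<Longrightarrow> poly q (\<xi> i) = poly r (\<xi> i)"
  shows "q = (r :: real poly)"
  using assms by (intro poly_eqI_degree[of "\<xi> ` {..p}"]) (auto simp: card_image)

lemma poly_of_lagrange:
  assumes "inj_on \<xi> {..p}" "i \<le> p"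
  shows "poly (poly_of p (lagrange p \<xi>) c) (\<xi> i) = c $ i"
  using assms
  by (simp add: poly_of_def poly_sum poly_lagrange if_distrib[of "(*) _"] cong: if_cong)

lemma degree_poly_of_lagrange: "degree (poly_of p (lagrange p \<xi>) c) \<le> p"
  unfolding poly_of_def
  by (intro degree_sum_le) (auto intro: order_trans[OF degree_smult_le] degree_lagrange)

lemma interpolation:
  assumes "inj_on \<xi> {..p}" "degree q \<le> p"
  shows "poly_of p (lagrange p \<xi>) (Matrix.vec (Suc p) (\<lambda>i. poly q (\<xi> i))) = q"
  using assms by (intro poly_eq_at_nodes[of \<xi> p]) (auto simp: degree_poly_of_lagrange poly_of_lagrange)

lemma poly_basis_lagrange:
  assumes "inj_on \<xi> {..p}"
  shows "poly_basis p (lagrange p \<xi>)"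
  unfolding poly_basis_def
proof (intro conjI allI impI ex_ex1I)
  fix q :: "real poly" assume "degree q \<le> p"
  from interpolation[OF assms this]
  show "\<exists>c. c \<in> carrier_vec (Suc p) \<and> poly_of p (lagrange p \<xi>) c = q"
    by (intro exI conjI) auto
next
  fix q c d
  assume c: "c \<in> carrier_vec (Suc p) \<and> poly_of p (lagrange p \<xi>) c = q"
    and d: "d \<in> carrier_vec (Suc p) \<and> poly_of p (lagrange p \<xi>) d = q"
  have "c $ i = d $ i" if "i \<le> p" for i
    using poly_of_lagrange[OF assms that, of c] poly_of_lagrange[OF assms that, of d] c d by simp
  with c d show "c = d" by (intro eq_vecI) auto
qed (simp add: degree_lagrange)

section \<open>Interpolatory quadrature and its degree of exactness\<close>

abbreviation weight :: "nat \<Rightarrow> (nat \<Rightarrow> real) \<Rightarrow> nat \<Rightarrow> real" where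
  "weight p \<xi> i \<equiv> ref_integral (lagrange p \<xi> i)"

text \<open>The weights integrate the Lagrange polynomials by construction, and interpolation
  reproduces polynomials of this degree.\<close>

lemma quadrature_interpolatory:
  assumes "inj_on \<xi> {..p}" "degree q \<le> p"
  shows "ref_integral q = (\<Sum>i\<le>p. weight p \<xi> i * poly q (\<xi> i))"
proof -
  have "ref_integral q
      = ref_integral (poly_of p (lagrange p \<xi>) (Matrix.vec (Suc p) (\<lambda>i. poly q (\<xi> i))))"
    by (simp add: interpolation[OF assms])
  also have "\<dots> = (\<Sum>i\<le>p. weight p \<xi> i * poly q (\<xi> i))"
    by (simp add: poly_of_def ref_integral_sum ref_integral_smult mult.commute)
  finally show ?thesis .
qed

text \<open>Divide \<open>r\<close> by the nodal polynomial \<omega>. The quotient has degree below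
  \<open>m\<close>, so its contribution integrates to zero by orthogonality. The remainder is
  integrated exactly and agrees with \<open>r\<close> at the nodes. The gain \<open>m\<close> is p +
  1 for Gauss and p - 1 for Lobatto nodes.\<close>

lemma quadrature_exact:
  assumes inj: "inj_on \<xi> {..p}"
    and \<omega>: "degree \<omega> = Suc p" "\<And>i. i \<le> p \<Longrightarrow> poly \<omega> (\<xi> i) = 0"
    and orth: "\<And>q. degree q < m \<Longrightarrow> ref_integral (\<omega> * q) = 0"
    and deg: "degree r < Suc p + m"
  shows "ref_integral r = (\<Sum>i\<le>p. weight p \<xi> i * poly r (\<xi> i))"
proof -
  define k t where "k = r div \<omega>" and "t = r mod \<omega>"
  have r: "r = \<omega> * k + t" by (simp add: k_def t_def)
  have \<omega>0: "\<omega> \<noteq> 0" using \<omega>(1) by auto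
  have t: "degree t \<le> p"
    using degree_mod_less[OF \<omega>0, of r] \<omega>(1) by (auto simp: t_def)
  have "ref_integral (\<omega> * k) = 0"
  proof (cases "k = 0")
    case False
    have "Suc p + degree k = degree (r - t)"
      using False \<omega>0 \<omega>(1) r by (simp add: degree_mult_eq)
    also have "\<dots> \<le> max (degree r) (degree t)" by (rule degree_diff_le_max)
    finally have "Suc p + degree k \<le> degree r" using t by simp
    with deg show ?thesis by (intro orth) simp
  qed simp
  then have "ref_integral r = ref_integral t"
    by (simp add: r ref_integral_add)
  also have "\<dots> = (\<Sum>i\<le>p. weight p \<xi> i * poly t (\<xi> i))"
    by (rule quadrature_interpolatory[OF inj t])
  also have "\<dots> = (\<Sum>i\<le>p. weight p \<xi> i * poly r (\<xi> i))"
    using \<omega>(2) by (simp add: r)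
  finally show ?thesis .
qed

lemma sum_single_node:
  assumes "i \<le> p" "\<And>j. j \<le> p \<Longrightarrow> j \<noteq> i \<Longrightarrow> h j = (0 :: real)"
  shows "(\<Sum>j\<le>p. weight p \<xi> j * h j) = weight p \<xi> i * h i"
proof -
  have "(\<Sum>j\<le>p. weight p \<xi> j * h j) = (\<Sum>j\<le>p. if j = i then weight p \<xi> i * h i else 0)"
    using assms(2) by (intro sum.cong) auto
  then show ?thesis using assms(1) by simp
qed

section \<open>Positivity of the Gauss and Lobatto weights\<close>

lemma gauss_nodes_inj: "gauss_nodes p \<xi> \<Longrightarrow> inj_on \<xi> {..p}"
  by (auto simp: gauss_nodes_def strict_mono_on_imp_inj_on)

lemma lobatto_nodes_inj: "lobatto_nodes p \<xi> \<Longrightarrow> inj_on \<xi> {..p}"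
  by (auto simp: lobatto_nodes_def strict_mono_on_imp_inj_on)

text \<open>The test polynomial is the square of the Lagrange polynomial: its degree is at most 2p,
  within the exactness of the rule, its integral is positive, and only node \<open>i\<close>
  contributes to the sum.\<close>

lemma gauss_weight_pos:
  assumes "gauss_nodes p \<xi>" "i \<le> p"
  shows "0 < weight p \<xi> i"
proof -
  let ?l = "lagrange p \<xi> i"
  note inj = gauss_nodes_inj[OF assms(1)]
  have "?l \<noteq> 0" using poly_lagrange[OF inj assms(2) assms(2)] by auto
  then have "0 < ref_integral (?l * ?l)" by (rule ref_integral_square_pos)
  also have "ref_integral (?l * ?l) = (\<Sum>j\<le>p. weight p \<xi> j * poly (?l * ?l) (\<xi> j))"
  proof (rule quadrature_exact[OF inj, of "legendre (Suc p)" "Suc p"])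
    show "poly (legendre (Suc p)) (\<xi> j) = 0" if "j \<le> p" for j
      using assms(1) that unfolding gauss_nodes_def by blast
    show "degree (?l * ?l) < Suc p + Suc p"
      using degree_mult_le[of ?l ?l] degree_lagrange[OF assms(2), of \<xi>] by simp
  qed (auto simp: degree_legendre legendre_orthogonal)
  also have "\<dots> = weight p \<xi> i * poly (?l * ?l) (\<xi> i)"
    using assms(2) inj by (intro sum_single_node) (auto simp: poly_lagrange)
  also have "\<dots> = weight p \<xi> i"
    using assms(2) inj by (simp add: poly_lagrange)
  finally show ?thesis .
qed

text \<open>One integration by parts moves the derivative away from the Legendre polynomial. The
  factor x^2 - 1 removes the boundary terms, and the other factor is left with degree below
  \<open>p\<close>.\<close>

lemma lobatto_orthogonal:
  assumes "degree q < p - 1"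
  shows "ref_integral ([:-1, 0, 1:] * pderiv (legendre p) * q) = 0"
proof -
  let ?r = "[:-1, 0, 1:] * q"
  have "degree ?r \<le> 2 + degree q"
    using degree_mult_le[of "[:-1, 0, 1 :: real:]" q] by simp
  then have deg: "degree (pderiv ?r) < p"
    using assms by (simp only: degree_pderiv)
  have "ref_integral (pderiv (legendre p) * ?r) = - ref_integral (legendre p * pderiv ?r)"
    by (rule ref_integral_by_parts) auto
  also have "\<dots> = 0" using legendre_orthogonal[OF deg] by simp
  finally show ?thesis by (simp only: ac_simps)
qed

lemma lobatto_exact:
  assumes "lobatto_nodes p \<xi>" "degree r < 2 * p"
  shows "ref_integral r = (\<Sum>i\<le>p. weight p \<xi> i * poly r (\<xi> i))"
proof (rule quadrature_exact[OF lobatto_nodes_inj[OF assms(1)],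
      of "[:-1, 0, 1:] * pderiv (legendre p)" "p - 1"])
  have p: "p \<ge> 1" using assms(1) by (simp add: lobatto_nodes_def)
  have "pderiv (legendre p) \<noteq> 0" using p by (simp add: pderiv_eq_0_iff degree_legendre)
  then show "degree ([:-1, 0, 1:] * pderiv (legendre p)) = Suc p"
    using p by (subst degree_mult_eq) (auto simp: degree_pderiv degree_legendre)
  show "degree r < Suc p + (p - 1)" using assms(2) p by simp
  show "poly ([:-1, 0, 1:] * pderiv (legendre p)) (\<xi> i) = 0" if "i \<le> p" for i
  proof -
    have "\<xi> i \<in> {-1, 1} \<union> {z. poly (pderiv (legendre p)) z = 0}"
      using assms(1) that unfolding lobatto_nodes_def by blast
    then show ?thesis by auto
  qed
qed (rule lobatto_orthogonal)

lemma degree_root_product: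
  "finite Z \<Longrightarrow> degree (\<Prod>z\<in>Z. [:- z, 1 :: real:]) = card Z"
  by (subst degree_prod_eq_sum_degree) auto

text \<open>The square of a Lagrange polynomial can have degree 2p, one too many for this rule.
  Hence only the interior roots are squared, in \<open>k\<close>, while the endpoints enter through
  a simple factor \<open>h\<close> of constant sign on the element.\<close>

lemma lobatto_weight_pos:
  assumes L: "lobatto_nodes p \<xi>" and i: "i \<le> p"
  shows "0 < weight p \<xi> i"
proof -
  define Z where "Z = {z. poly (pderiv (legendre p)) z = 0}"
  have p: "p \<ge> 1" and nodes: "\<xi> ` {..p} = {-1, 1} \<union> Z"
    using L by (auto simp: lobatto_nodes_def Z_def)
  note inj = lobatto_nodes_inj[OF L]
  have P0: "pderiv (legendre p) \<noteq> 0" using p by (simp add: pderiv_eq_0_iff degree_legendre)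
  have finZ: "finite Z" unfolding Z_def by (rule poly_roots_finite[OF P0])
  have cardZ: "card Z \<le> p - 1"
    unfolding Z_def using card_poly_roots_bound[OF P0] by (simp add: degree_pderiv degree_legendre)
  \<comment> \<open>There are p + 1 distinct nodes but at most p - 1 roots in \<open>Z\<close>, so
    the endpoints cannot be among these roots.\<close>
  have "card ({-1, 1} \<union> Z) = Suc p"
    using card_image[OF inj] by (simp add: nodes)
  moreover have "card ({-1, 1} \<union> Z) + card ({-1, 1} \<inter> Z) = 2 + card Z"
    using card_Un_Int[of "{-1, 1}" Z] finZ by simp
  ultimately have "card ({-1, 1} \<inter> Z) = 0" using cardZ p by linarith
  then have disj: "{-1, 1} \<inter> Z = {}" using finZ by simp
  define k where "k = (\<Prod>z\<in>Z - {\<xi> i}. [:- z, 1 :: real:])"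
  have k0: "k \<noteq> 0" by (simp add: k_def finZ)
  have degk: "degree k = card (Z - {\<xi> i})" by (simp add: k_def degree_root_product finZ)
  have k_eq_0: "poly k (\<xi> j) = 0" if "j \<le> p" "j \<noteq> i" "\<xi> j \<in> Z" for j
    using that i inj finZ by (auto simp: k_def poly_prod prod_zero_iff dest: inj_onD)
  have node_cases: "\<xi> j = -1 \<or> \<xi> j = 1 \<or> \<xi> j \<in> Z" if "j \<le> p" for j
    using nodes that by blast
  \<comment> \<open>Interior nodes other than \<open>\<xi> i\<close> are roots of \<open>k\<close>,
    and \<open>h\<close> is required to vanish at the endpoints other than \<open>\<xi> i\<close>;
    exactly one term of the quadrature remains.\<close>
  have eval: "ref_integral (h * (k * k)) = weight p \<xi> i * (poly h (\<xi> i) * (poly k (\<xi> i))\<^sup>2)"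
    if "degree (h * (k * k)) < 2 * p"
      and "\<And>x. x = -1 \<or> x = 1 \<Longrightarrow> x \<noteq> \<xi> i \<Longrightarrow> poly h x = 0" for h
  proof -
    have "ref_integral (h * (k * k)) = (\<Sum>j\<le>p. weight p \<xi> j * poly (h * (k * k)) (\<xi> j))"
      by (rule lobatto_exact[OF L that(1)])
    also have "\<dots> = weight p \<xi> i * poly (h * (k * k)) (\<xi> i)"
    proof (rule sum_single_node[OF i])
      fix j assume j: "j \<le> p" "j \<noteq> i"
      then have "\<xi> j \<noteq> \<xi> i" using inj i by (auto dest: inj_onD)
      then show "poly (h * (k * k)) (\<xi> j) = 0"
        using node_cases[OF j(1)] k_eq_0[OF j] that(2)[of "\<xi> j"] by auto
    qed
    finally show ?thesis by (simp add: power2_eq_square)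
  qed
  have deg: "degree (h * (k * k)) \<le> degree h + 2 * degree k" for h
    using degree_mult_le[of h "k * k"] degree_mult_le[of k k] by linarith
  have signed: "0 < weight p \<xi> i * (poly h (\<xi> i) * (poly k (\<xi> i))\<^sup>2)"
    if "degree h + 2 * degree k < 2 * p" "h \<noteq> 0"
      and "\<And>x. x = -1 \<or> x = 1 \<Longrightarrow> x \<noteq> \<xi> i \<Longrightarrow> poly h x = 0"
      and "\<And>x. -1 \<le> x \<Longrightarrow> x \<le> 1 \<Longrightarrow> 0 \<le> poly h x" for h
  proof -
    have "0 < ref_integral (h * (k * k))"
      using that k0 by (intro ref_integral_pos) auto
    then show ?thesis using eval[of h] deg[of h] that by simp
  qed
  show ?thesis
  proof (cases "\<xi> i \<in> Z")
    case False
    have "degree k \<le> p - 1" using degk False cardZ by simp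
    then have d: "1 + 2 * degree k < 2 * p" using p by simp
    from False node_cases[OF i] consider "\<xi> i = 1" | "\<xi> i = -1" by blast
    then show ?thesis
    proof cases
      case 1
      have "0 < weight p \<xi> i * (poly [:1, 1:] (\<xi> i) * (poly k (\<xi> i))\<^sup>2)"
        by (rule signed) (use d 1 in auto)
      then show ?thesis using 1 by (auto simp: zero_less_mult_iff)
    next
      case 2
      have "0 < weight p \<xi> i * (poly [:1, -1:] (\<xi> i) * (poly k (\<xi> i))\<^sup>2)"
        by (rule signed) (use d 2 in auto)
      then show ?thesis using 2 by (auto simp: zero_less_mult_iff)
    qed
  next
    case True
    \<comment> \<open>Leaving \<open>\<xi> i\<close> out of \<open>k\<close> frees two degrees in
      its square, which makes room for a factor \<open>h\<close> of degree 2 or even 3.\<close>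
    then have "card Z \<ge> 1" using finZ by (auto simp: Suc_le_eq card_gt_0_iff)
    then have d: "degree k + 2 \<le> p" using degk True cardZ finZ by simp
    have ne: "\<xi> i \<noteq> 1" "\<xi> i \<noteq> -1" using True disj by auto
    have sq: "0 \<le> 1 - x * x" if "-1 \<le> x" "x \<le> 1" for x :: real
      using that abs_square_le_1[of x] by (simp add: power2_eq_square abs_le_iff)
    have pos: "0 < weight p \<xi> i * (poly [:1, 0, -1:] (\<xi> i) * (poly k (\<xi> i))\<^sup>2)"
      by (rule signed) (use d sq in auto)
    \<comment> \<open>For a node outside the reference element, the polynomial \<open>(1 - x\<^sup>2) (x - \<xi> i) k\<^sup>2\<close> vanishes at
      all nodes and is integrated exactly, but has a constant sign on the element.\<close>
    have "\<not> 1 \<le> \<xi> i"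
    proof
      assume ge: "1 \<le> \<xi> i"
      have "0 < weight p \<xi> i * (poly ([:1, 0, -1:] * [:\<xi> i, -1:]) (\<xi> i) * (poly k (\<xi> i))\<^sup>2)"
      proof (rule signed)
        show "0 \<le> poly ([:1, 0, -1:] * [:\<xi> i, -1:]) x" if "-1 \<le> x" "x \<le> 1" for x
          using sq[OF that] ge that by (simp only: poly_mult) (intro mult_nonneg_nonneg, auto)
        show "degree ([:1, 0, -1:] * [:\<xi> i, -1:]) + 2 * degree k < 2 * p"
          using d degree_mult_le[of "[:1, 0, -1:]" "[:\<xi> i, -1:]"] by simp
      qed auto
      then show False by simp
    qed
    moreover have "\<not> \<xi> i \<le> -1"
    proof
      assume le: "\<xi> i \<le> -1"
      have "0 < weight p \<xi> i * (poly ([:1, 0, -1:] * [:- \<xi> i, 1:]) (\<xi> i) * (poly k (\<xi> i))\<^sup>2)"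
      proof (rule signed)
        show "0 \<le> poly ([:1, 0, -1:] * [:- \<xi> i, 1:]) x" if "-1 \<le> x" "x \<le> 1" for x
          using sq[OF that] le that by (simp only: poly_mult) (intro mult_nonneg_nonneg, auto)
        show "degree ([:1, 0, -1:] * [:- \<xi> i, 1:]) + 2 * degree k < 2 * p"
          using d degree_mult_le[of "[:1, 0, -1:]" "[:- \<xi> i, 1:]"] by simp
      qed auto
      then show False by simp
    qed
    \<comment> \<open>With the node located inside the element, the factor multiplying the weight in
      \<open>pos\<close> is nonnegative, and positivity of the product passes to the weight.\<close>
    ultimately have "0 \<le> poly [:1, 0, -1:] (\<xi> i)" using sq[of "\<xi> i"] by simp
    then have "0 \<le> poly [:1, 0, -1:] (\<xi> i) * (poly k (\<xi> i))\<^sup>2"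
      by (intro mult_nonneg_nonneg) auto
    then show ?thesis
      using pos zero_less_mult_iff[of "weight p \<xi> i" "poly [:1, 0, -1:] (\<xi> i) * (poly k (\<xi> i))\<^sup>2"]
      by linarith
  qed
qed

section \<open>Scalar products on polynomials\<close>

text \<open>Common properties of the exact product and of both quadratures. \<open>one_left\<close>
  is exactness against constants: it gives S 1 1 = 2 and makes the higher Legendre polynomials up to
  degree \<open>p\<close> orthogonal to constants.\<close>

locale element_product =
  fixes p :: nat and S :: "real poly \<Rightarrow> real poly \<Rightarrow> real"
  assumes add_left: "S (q + r) t = S q t + S r t"
    and smult_left: "S (Polynomial.smult c q) t = c * S q t"
    and commute: "S q r = S r q"
    and pos: "q \<noteq> 0 \<Longrightarrow> degree q \<le> p \<Longrightarrow> 0 < S q q"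
    and one_left: "degree q \<le> p \<Longrightarrow> S 1 q = ref_integral q"
begin

lemma add_right: "S t (q + r) = S t q + S t r"
  by (metis add_left commute)

lemma smult_right: "S t (Polynomial.smult c q) = c * S t q"
  by (metis smult_left commute)

lemma zero_left: "S 0 t = 0"
  using smult_left[of 0 0 t] by simp

lemma sum_left: "S (\<Sum>i\<in>A. q i) t = (\<Sum>i\<in>A. S (q i) t)"
  by (induction A rule: infinite_finite_induct) (auto simp: zero_left add_left)

lemma sum_right: "S t (\<Sum>i\<in>A. q i) = (\<Sum>i\<in>A. S t (q i))"
  by (simp add: commute[of t] sum_left)

lemma nonneg: "degree q \<le> p \<Longrightarrow> 0 \<le> S q q"
  using pos[of q] zero_left[of 0] by (cases "q = 0") auto

lemma sum_sum:
  "S (\<Sum>i\<in>A. Polynomial.smult (c i) (q i)) (\<Sum>j\<in>B. Polynomial.smult (d j) (r j))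
    = (\<Sum>i\<in>A. \<Sum>j\<in>B. c i * d j * S (q i) (r j))"
proof -
  have "S (\<Sum>i\<in>A. Polynomial.smult (c i) (q i)) (\<Sum>j\<in>B. Polynomial.smult (d j) (r j))
      = (\<Sum>i\<in>A. c i * S (q i) (\<Sum>j\<in>B. Polynomial.smult (d j) (r j)))"
    by (simp only: sum_left smult_left)
  also have "\<dots> = (\<Sum>i\<in>A. \<Sum>j\<in>B. c i * d j * S (q i) (r j))"
    by (simp only: sum_right smult_right sum_distrib_left mult.assoc)
  finally show ?thesis .
qed

text \<open>By bilinearity, computations with coefficient vectors turn into computations with
  polynomials, whatever the basis.\<close>

lemma inner_M_mass_matrix:
  assumes "u \<in> carrier_vec (Suc p)" "v \<in> carrier_vec (Suc p)"
  shows "inner_M (mass_matrix p b S) u v = S (poly_of p b u) (poly_of p b v)"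
proof -
  have "inner_M (mass_matrix p b S) u v = (\<Sum>i\<le>p. u $ i * (\<Sum>j\<le>p. S (b i) (b j) * v $ j))"
    using assms by (simp add: inner_M_def mass_matrix_def scalar_prod_def mult_mat_vec_def
        atLeast0LessThan lessThan_Suc_atMost del: sum.atMost_Suc)
  also have "\<dots> = S (poly_of p b u) (poly_of p b v)"
    unfolding poly_of_def sum_sum by (simp add: sum_distrib_left mult_ac)
  finally show ?thesis .
qed

lemma sqnorm_M_mass_matrix:
  "u \<in> carrier_vec (Suc p) \<Longrightarrow>
    sqnorm_M (mass_matrix p b S) u = S (poly_of p b u) (poly_of p b u)"
  by (simp add: sqnorm_M_def inner_M_mass_matrix)

text \<open>With \<open>t\<close> the time step, this is the expansion of the squared norm of the
  Euler value in the filter condition.\<close>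

lemma square_add_smult:
  "S (q + Polynomial.smult t r) (q + Polynomial.smult t r) = S q q + 2 * t * S q r + t\<^sup>2 * S r r"
  by (simp add: add_left add_right smult_left smult_right commute[of r q] power2_eq_square algebra_simps)

text \<open>Since \<open>S 1 1 = 2\<close>, this is the squared norm of the difference of \<open>q\<close> and its mean value: the
  supremum of what the filter can remove.\<close>

definition fluctuation :: "real poly \<Rightarrow> real" where
  "fluctuation q = S q q - (ref_integral q)\<^sup>2 / 2"

lemma fluctuation_eq:
  assumes "degree q \<le> p" and "m = ref_integral q / 2"
  shows "fluctuation q = S (q + Polynomial.smult (- m) 1) (q + Polynomial.smult (- m) 1)"
proof -
  have "S q 1 = 2 * m" using assms one_left[of q] by (simp add: commute[of q])
  moreover have "S 1 1 = 2" using one_left[of 1] by (simp add: ref_integral_1)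
  ultimately show ?thesis
    using assms(2) unfolding fluctuation_def square_add_smult
    by (simp add: power2_eq_square field_simps)
qed

lemma fluctuation_pos:
  assumes "degree q \<le> p" and "\<not> (\<exists>c. q = [:c:])"
  shows "0 < fluctuation q"
proof -
  let ?m = "ref_integral q / 2"
  have "q + Polynomial.smult (- ?m) 1 \<noteq> 0"
  proof
    assume "q + Polynomial.smult (- ?m) 1 = 0"
    then have "q = - Polynomial.smult (- ?m) 1" by (simp only: eq_neg_iff_add_eq_0)
    then have "q = [:?m:]" by (simp add: one_pCons)
    with assms(2) show False by blast
  qed
  moreover have "degree (q + Polynomial.smult (- ?m) 1) \<le> p"
    using assms(1) by (intro degree_add_le) auto
  ultimately show ?thesis
    using pos fluctuation_eq[OF assms(1) refl] by simp
qed

text \<open>Used contrapositively: a positive fluctuation certifies that a value is not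
  constant.\<close>

lemma fluctuation_const: "fluctuation [:c:] = 0"
proof -
  have c: "[:c:] = Polynomial.smult c 1" by (simp add: one_pCons)
  have "S 1 1 = 2" using one_left[of 1] by (simp add: ref_integral_1)
  then show ?thesis
    unfolding fluctuation_def c
    by (simp only: smult_left smult_right ref_integral_smult ref_integral_1 power2_eq_square)
qed

end

section \<open>Verification for the admissible products and bases\<close>

lemma element_product_L2: "element_product p L2_product"
proof
  fix q r t :: "real poly" and c :: real
  show "L2_product (q + r) t = L2_product q t + L2_product r t"
    by (simp add: L2_product_def distrib_right ref_integral_add)
  show "L2_product (Polynomial.smult c q) t = c * L2_product q t"
    by (simp add: L2_product_def ref_integral_smult)
  show "L2_product q r = L2_product r q"
    by (simp add: L2_product_def mult.commute)
  show "L2_product 1 q = ref_integral q"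
    by (simp add: L2_product_def)
  show "0 < L2_product q q" if "q \<noteq> 0"
    unfolding L2_product_def by (rule ref_integral_square_pos[OF that])
qed

text \<open>A nonzero polynomial of degree at most \<open>p\<close> cannot vanish at all p + 1
  nodes, so with positive weights some term of its squared norm is positive and none is
  negative.\<close>

lemma element_product_quadrature:
  assumes inj: "inj_on \<xi> {..p}" and weights: "\<And>i. i \<le> p \<Longrightarrow> 0 < weight p \<xi> i"
  shows "element_product p (quadrature_product p \<xi>)"
proof
  fix q r t :: "real poly" and c :: real
  show "quadrature_product p \<xi> (q + r) t = quadrature_product p \<xi> q t + quadrature_product p \<xi> r t"
    by (simp add: quadrature_product_def algebra_simps sum.distrib)
  show "quadrature_product p \<xi> (Polynomial.smult c q) t = c * quadrature_product p \<xi> q t"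
    by (simp add: quadrature_product_def sum_distrib_left mult_ac)
  show "quadrature_product p \<xi> q r = quadrature_product p \<xi> r q"
    by (simp add: quadrature_product_def mult_ac)
  show "quadrature_product p \<xi> 1 q = ref_integral q" if "degree q \<le> p"
    using quadrature_interpolatory[OF inj that] by (simp add: quadrature_product_def)
  show "0 < quadrature_product p \<xi> q q" if "q \<noteq> 0" "degree q \<le> p"
  proof -
    obtain i where i: "i \<le> p" "poly q (\<xi> i) \<noteq> 0"
      using poly_eq_at_nodes[OF inj \<open>degree q \<le> p\<close>, of 0] \<open>q \<noteq> 0\<close> by auto
    have "0 < poly q (\<xi> i) * poly q (\<xi> i)"
      using i(2) not_real_square_gt_zero by blast
    then have "0 < weight p \<xi> i * poly q (\<xi> i) * poly q (\<xi> i)"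
      unfolding mult.assoc by (rule mult_pos_pos[OF weights[OF i(1)]])
    moreover have "0 \<le> weight p \<xi> j * poly q (\<xi> j) * poly q (\<xi> j)" if "j \<le> p" for j
      using weights[OF that] by (simp add: mult.assoc)
    ultimately show ?thesis
      unfolding quadrature_product_def using i(1) by (intro sum_pos2[of _ i]) auto
  qed
qed

lemma admissible_product_element_product:
  "admissible_product p S \<Longrightarrow> element_product p S"
  unfolding admissible_product_def
  by (auto simp: element_product_L2 gauss_nodes_inj lobatto_nodes_inj gauss_weight_pos
      lobatto_weight_pos intro!: element_product_quadrature)

lemma admissible_basis_poly_basis: "admissible_basis p b \<Longrightarrow> poly_basis p b"
  unfolding admissible_basis_def
  by (auto simp: poly_basis_legendre gauss_nodes_inj lobatto_nodes_inj intro: poly_basis_lagrange)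

section \<open>The modal filter\<close>

abbreviation damping :: "nat \<Rightarrow> real \<Rightarrow> real \<Rightarrow> nat \<Rightarrow> real" where
  "damping s \<Delta>t \<epsilon> n \<equiv> exp (- \<epsilon> * (real n * (real n + 1)) ^ s * \<Delta>t)"

lemma filter_matrix_carrier: "filter_matrix p b s \<epsilon> \<Delta>t \<in> carrier_mat (Suc p) (Suc p)"
  unfolding filter_matrix_def basis_change_def modal_filter_def
  by (intro mult_carrier_mat[where n = "Suc p"]) auto

text \<open>The filter scales the modal coefficients. The witness \<open>a\<close> is chosen before
  the filter parameters, so the filtered value becomes an explicit function of the strength with
  fixed coefficients.\<close>

lemma poly_of_filter:
  assumes b: "poly_basis p b" and w: "w \<in> carrier_vec (Suc p)"
  shows "\<exists>a. poly_of p b w = poly_of p legendre a \<and>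
    (\<forall>s \<epsilon> \<Delta>t. poly_of p b (filter_matrix p b s \<epsilon> \<Delta>t *\<^sub>v w)
      = (\<Sum>n\<le>p. Polynomial.smult (damping s \<Delta>t \<epsilon> n * a $ n) (legendre n)))"
proof -
  define a where "a = basis_change p b legendre *\<^sub>v w"
  have B: "basis_change p b c \<in> carrier_mat (Suc p) (Suc p)" for b c
    by (simp add: basis_change_def)
  have a: "a \<in> carrier_vec (Suc p)"
    unfolding a_def using B w by (rule mult_mat_vec_carrier)
  have unfiltered: "poly_of p legendre a = poly_of p b w"
    unfolding a_def using b w
    by (intro poly_of_basis_change) (auto simp: poly_basis_legendre poly_basis_degree)
  have "poly_of p b (filter_matrix p b s \<epsilon> \<Delta>t *\<^sub>v w)
      = (\<Sum>n\<le>p. Polynomial.smult (damping s \<Delta>t \<epsilon> n * a $ n) (legendre n))" for s \<epsilon> \<Delta>t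
  proof -
    have F: "modal_filter p s \<epsilon> \<Delta>t \<in> carrier_mat (Suc p) (Suc p)"
      by (simp add: modal_filter_def)
    have D: "modal_filter p s \<epsilon> \<Delta>t *\<^sub>v a = Matrix.vec (Suc p) (\<lambda>n. damping s \<Delta>t \<epsilon> n * a $ n)"
    proof (rule eq_vecI)
      fix n assume "n < dim_vec (Matrix.vec (Suc p) (\<lambda>n. damping s \<Delta>t \<epsilon> n * a $ n))"
      then have n: "n < Suc p" by simp
      have "(modal_filter p s \<epsilon> \<Delta>t *\<^sub>v a) $ n
          = (\<Sum>j<Suc p. (if n = j then damping s \<Delta>t \<epsilon> j else 0) * a $ j)"
        using n a unfolding modal_filter_def mat_diag_def
        by (simp add: scalar_prod_def atLeast0LessThan del: sum.lessThan_Suc)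
      also have "\<dots> = (\<Sum>j<Suc p. if n = j then damping s \<Delta>t \<epsilon> j * a $ j else 0)"
        by (intro sum.cong) auto
      also have "\<dots> = damping s \<Delta>t \<epsilon> n * a $ n"
        using n by (simp del: sum.lessThan_Suc)
      finally show "(modal_filter p s \<epsilon> \<Delta>t *\<^sub>v a) $ n
          = Matrix.vec (Suc p) (\<lambda>n. damping s \<Delta>t \<epsilon> n * a $ n) $ n"
        using n by simp
    qed (simp add: carrier_matD[OF F])
    have "filter_matrix p b s \<epsilon> \<Delta>t *\<^sub>v w
        = basis_change p legendre b *\<^sub>v (modal_filter p s \<epsilon> \<Delta>t *\<^sub>v a)"
      unfolding filter_matrix_def a_def
      by (simp only: assoc_mult_mat_vec[OF mult_carrier_mat[OF B F] B w]
          assoc_mult_mat_vec[OF B F a[unfolded a_def]])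
    also have "poly_of p b \<dots> = poly_of p legendre (modal_filter p s \<epsilon> \<Delta>t *\<^sub>v a)"
      by (rule poly_of_basis_change[OF _ b mult_mat_vec_carrier[OF F a]]) (simp add: degree_legendre)
    also have "\<dots> = (\<Sum>n\<le>p. Polynomial.smult (damping s \<Delta>t \<epsilon> n * a $ n) (legendre n))"
      unfolding D by (simp add: poly_of_def)
    finally show ?thesis .
  qed
  then show ?thesis
    by (intro exI[of _ a] conjI allI unfiltered[symmetric])
qed

text \<open>Only mode 0 carries the integral, and it is left undamped: its eigenvalue is 0, and 0^s
  = 0 because \<open>s\<close> is at least 1.\<close>

lemma ref_integral_filter:
  assumes "poly_basis p b" "w \<in> carrier_vec (Suc p)" "s \<ge> 1"
  shows "ref_integral (poly_of p b (filter_matrix p b s \<epsilon> \<Delta>t *\<^sub>v w)) = ref_integral (poly_of p b w)"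
proof -
  obtain a where a: "poly_of p b w = poly_of p legendre a"
    and F: "poly_of p b (filter_matrix p b s \<epsilon> \<Delta>t *\<^sub>v w)
      = (\<Sum>n\<le>p. Polynomial.smult (damping s \<Delta>t \<epsilon> n * a $ n) (legendre n))"
    using poly_of_filter[OF assms(1,2)] by blast
  show ?thesis
    unfolding F a ref_integral_poly_of_legendre using assms(3)
    by (simp add: ref_integral_sum ref_integral_smult ref_integral_legendre
        if_distrib[of "(*) _"] cong: if_cong)
qed

lemma poly_of_filter_0:
  assumes "poly_basis p b" "w \<in> carrier_vec (Suc p)"
  shows "poly_of p b (filter_matrix p b s 0 \<Delta>t *\<^sub>v w) = poly_of p b w"
proof -
  obtain a where a: "poly_of p b w = poly_of p legendre a"
    and F: "poly_of p b (filter_matrix p b s 0 \<Delta>t *\<^sub>v w)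
      = (\<Sum>n\<le>p. Polynomial.smult (damping s \<Delta>t 0 n * a $ n) (legendre n))"
    using poly_of_filter[OF assms] by blast
  show ?thesis unfolding F a by (simp add: poly_of_def)
qed

lemma damping_tendsto:
  assumes "\<Delta>t > 0" "s \<ge> 1"
  shows "((\<lambda>\<epsilon>. damping s \<Delta>t \<epsilon> n) \<longlongrightarrow> (if n = 0 then 1 else 0)) at_top"
proof (cases "n = 0")
  case True
  then show ?thesis using assms by (simp add: power_0_left)
next
  case False
  define k where "k = (real n * (real n + 1)) ^ s * \<Delta>t"
  have "k > 0" using False assms by (simp add: k_def)
  then have "filterlim (\<lambda>\<epsilon>. k * \<epsilon>) at_top at_top"
    by (intro filterlim_tendsto_pos_mult_at_top[OF tendsto_const]) (auto intro: filterlim_ident)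
  then have "((\<lambda>\<epsilon>. exp (- (k * \<epsilon>))) \<longlongrightarrow> 0) at_top"
    by (intro filterlim_compose[OF exp_at_bot]) (simp add: filterlim_uminus_at_bot)
  then show ?thesis using False by (simp add: k_def mult_ac)
qed

section \<open>The squared norm of the filtered value as a function of the strength\<close>

context element_product
begin

abbreviation filtered_square ::
  "(nat \<Rightarrow> real poly) \<Rightarrow> nat \<Rightarrow> real \<Rightarrow> real Matrix.vec \<Rightarrow> real \<Rightarrow> real" where
  "filtered_square b s \<Delta>t w \<epsilon> \<equiv>
     S (poly_of p b (filter_matrix p b s \<epsilon> \<Delta>t *\<^sub>v w)) (poly_of p b (filter_matrix p b s \<epsilon> \<Delta>t *\<^sub>v w))"

text \<open>The squared norm is a finite double sum over modes with dampings as factors, so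
  continuity and limit are taken termwise. In the limit only 2 (a 0)^2 survives, and the integral
  equals 2 (a 0), whence the half of its square.\<close>

lemma
  assumes "poly_basis p b" "w \<in> carrier_vec (Suc p)"
  shows filtered_square_continuous: "continuous_on A (filtered_square b s \<Delta>t w)"
    and filtered_square_tendsto: "\<Delta>t > 0 \<Longrightarrow> s \<ge> 1 \<Longrightarrow>
      (filtered_square b s \<Delta>t w \<longlongrightarrow> (ref_integral (poly_of p b w))\<^sup>2 / 2) at_top"
proof -
  obtain a where a: "poly_of p b w = poly_of p legendre a"
    and F: "\<And>\<epsilon>. poly_of p b (filter_matrix p b s \<epsilon> \<Delta>t *\<^sub>v w)
      = (\<Sum>n\<le>p. Polynomial.smult (damping s \<Delta>t \<epsilon> n * a $ n) (legendre n))"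
    using poly_of_filter[OF assms] by blast
  have eq: "filtered_square b s \<Delta>t w = (\<lambda>\<epsilon>. \<Sum>i\<le>p. \<Sum>j\<le>p.
      (damping s \<Delta>t \<epsilon> i * a $ i) * (damping s \<Delta>t \<epsilon> j * a $ j) * S (legendre i) (legendre j))"
    unfolding F sum_sum ..
  show "continuous_on A (filtered_square b s \<Delta>t w)"
    unfolding eq by (intro continuous_intros)
  assume "\<Delta>t > 0" "s \<ge> 1"
  then have "(filtered_square b s \<Delta>t w \<longlongrightarrow> (\<Sum>i\<le>p. \<Sum>j\<le>p.
      ((if i = 0 then 1 else 0) * a $ i) * ((if j = 0 then 1 else 0) * a $ j)
        * S (legendre i) (legendre j))) at_top"
    unfolding eq by (intro tendsto_intros damping_tendsto)
  also have "(\<Sum>i\<le>p. \<Sum>j\<le>p. ((if i = 0 then 1 else 0) * a $ i) * ((if j = 0 then 1 else 0) * a $ j)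
        * S (legendre i) (legendre j))
      = (\<Sum>i\<le>p. \<Sum>j\<le>p. if j = 0 then if i = 0 then a $ 0 * a $ 0 * S 1 1 else 0 else 0)"
    by (intro sum.cong refl) simp
  also have "\<dots> = (ref_integral (poly_of p b w))\<^sup>2 / 2"
    using one_left[of 1]
    by (simp add: a ref_integral_poly_of_legendre ref_integral_1 power2_eq_square)
  finally show "(filtered_square b s \<Delta>t w \<longlongrightarrow> (ref_integral (poly_of p b w))\<^sup>2 / 2) at_top" .
qed

text \<open>The inequality and the second equality of the condition follow from nonnegativity and
  from expanding the square. What remains is that the filter removes exactly the Euler
  excess.\<close>

lemma filter_condition_iff:
  assumes b: "poly_basis p b" and u: "u \<in> carrier_vec (Suc p)" and d: "d \<in> carrier_vec (Suc p)"
  shows "filter_condition p b (mass_matrix p b S) s \<epsilon> \<Delta>t u d \<longleftrightarrow>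
    filtered_square b s \<Delta>t (euler \<Delta>t u d) \<epsilon>
      = S (poly_of p b (euler \<Delta>t u d)) (poly_of p b (euler \<Delta>t u d))
        - \<Delta>t\<^sup>2 * S (poly_of p b d) (poly_of p b d)"
proof -
  have w: "euler \<Delta>t u d \<in> carrier_vec (Suc p)" using u d by (simp add: euler_def)
  have Fw: "filter_matrix p b s \<epsilon> \<Delta>t *\<^sub>v euler \<Delta>t u d \<in> carrier_vec (Suc p)"
    using filter_matrix_carrier w by (rule mult_mat_vec_carrier)
  have "0 \<le> \<Delta>t\<^sup>2 * S (poly_of p b d) (poly_of p b d)"
    by (simp add: nonneg degree_poly_of[OF b])
  then show ?thesis
    unfolding filter_condition_def
    by (auto simp: sqnorm_M_mass_matrix inner_M_mass_matrix u d w Fw poly_of_euler[OF u d]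
        square_add_smult)
qed

lemma ex_filter_condition:
  assumes b: "poly_basis p b" and u: "u \<in> carrier_vec (Suc p)" and d: "d \<in> carrier_vec (Suc p)"
    and "\<Delta>t > 0" "s \<ge> 1"
    and small: "\<Delta>t\<^sup>2 * S (poly_of p b d) (poly_of p b d) < fluctuation (poly_of p b (euler \<Delta>t u d))"
  shows "\<exists>\<epsilon>\<ge>0. filter_condition p b (mass_matrix p b S) s \<epsilon> \<Delta>t u d"
proof -
  let ?w = "euler \<Delta>t u d"
  let ?T = "S (poly_of p b ?w) (poly_of p b ?w) - \<Delta>t\<^sup>2 * S (poly_of p b d) (poly_of p b d)"
  have w: "?w \<in> carrier_vec (Suc p)" using u d by (simp add: euler_def)
  \<comment> \<open>The limit for infinite strength lies strictly below the target
    \<open>?T\<close>, so some finite strength \<open>E\<close> overshoots it.\<close>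
  have "(ref_integral (poly_of p b ?w))\<^sup>2 / 2 < ?T"
    using small by (simp add: fluctuation_def)
  with filtered_square_tendsto[OF b w \<open>\<Delta>t > 0\<close> \<open>s \<ge> 1\<close>]
  have "\<forall>\<^sub>F \<epsilon> in at_top. filtered_square b s \<Delta>t ?w \<epsilon> < ?T" by (rule order_tendstoD)
  then have "\<forall>\<^sub>F \<epsilon> in at_top. filtered_square b s \<Delta>t ?w \<epsilon> < ?T \<and> 0 \<le> \<epsilon>"
    by (rule eventually_conj) (rule eventually_ge_at_top)
  then obtain E where E: "filtered_square b s \<Delta>t ?w E < ?T" "0 \<le> E"
    using eventually_happens'[OF trivial_limit_at_top_linorder] by blast
  \<comment> \<open>At strength 0 the filter is the identity, so the value starts at or above the
    target.\<close>
  have "?T \<le> filtered_square b s \<Delta>t ?w 0"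
    by (simp add: poly_of_filter_0[OF b w] nonneg degree_poly_of[OF b])
  then have "\<exists>\<epsilon>\<ge>0. \<epsilon> \<le> E \<and> filtered_square b s \<Delta>t ?w \<epsilon> = ?T"
    using E by (intro IVT2' filtered_square_continuous[OF b w]) auto
  then show ?thesis using filter_condition_iff[OF b u d] by auto
qed

end

section \<open>Conservation and stability\<close>

lemma periodic_neighbour:
  assumes "i < (N :: nat)"
  shows "(Suc i mod N + N - Suc 0) mod N = i"
  using assms by (cases "Suc i = N") auto

lemma periodic_shift_bij:
  assumes "0 < (N :: nat)"
  shows "bij_betw (\<lambda>i. Suc i mod N) {..<N} {..<N}"
proof (rule bij_betw_byWitness[where f' = "\<lambda>i. (i + N - Suc 0) mod N"])
  show "\<forall>i\<in>{..<N}. Suc ((i + N - Suc 0) mod N) mod N = i"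
  proof
    fix i assume "i \<in> {..<N}"
    then show "Suc ((i + N - Suc 0) mod N) mod N = i"
      by (cases i) auto
  qed
qed (use assms in \<open>auto simp: periodic_neighbour\<close>)

text \<open>A cyclic shift of the left boundary terms regroups the sum by interfaces. The two terms
  meeting there see the same numerical flux, since the left flux of the next element is the right
  flux of the current one.\<close>

lemma stable_semidiscretisation_dissipative:
  assumes "stable_semidiscretisation g N X p b M rate" "U \<in> states N p" "0 < N"
  shows "(\<Sum>i<N. jac X i * inner_M M (U i) (rate U i)) \<le> 0"
proof -
  obtain \<beta>l \<beta>r where \<beta>: "\<And>i. i < N \<Longrightarrow> jac X i * inner_M M (U i) (rate U i) =
        \<beta>l (left_value p b U i) (left_flux g N p b U i) +
        \<beta>r (right_value p b U i) (right_flux g N p b U i)"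
    and interface: "\<And>a c. \<beta>r a (g a c) + \<beta>l c (g a c) \<le> 0"
    using assms unfolding stable_semidiscretisation_def by blast
  let ?l = "\<lambda>i. \<beta>l (left_value p b U i) (left_flux g N p b U i)"
  let ?r = "\<lambda>i. \<beta>r (right_value p b U i) (right_flux g N p b U i)"
  have "(\<Sum>i<N. jac X i * inner_M M (U i) (rate U i)) = (\<Sum>i<N. ?l i) + (\<Sum>i<N. ?r i)"
    by (simp add: \<beta> sum.distrib)
  also have "(\<Sum>i<N. ?l i) = (\<Sum>i<N. ?l (Suc i mod N))"
    by (rule sum.reindex_bij_betw[OF periodic_shift_bij[OF assms(3)], symmetric])
  also have "(\<Sum>i<N. ?l (Suc i mod N)) + (\<Sum>i<N. ?r i) = (\<Sum>i<N. ?r i + ?l (Suc i mod N))"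
    by (simp add: sum.distrib)
  also have "\<dots> \<le> 0"
    using interface by (intro sum_nonpos) (simp add: left_flux_def right_flux_def periodic_neighbour)
  finally show ?thesis .
qed

lemma jac_pos: "mesh N X \<Longrightarrow> i < N \<Longrightarrow> 0 < jac X i"
  using strict_mono_onD[of "{..N}" X i "Suc i"] by (simp add: mesh_def jac_def)

text \<open>The filter keeps the integral on each element, so only the Euler update changes it, and
  these changes cancel over the mesh.\<close>

lemma filtered_euler_conservative:
  assumes b: "poly_basis p b" and "s \<ge> 1" and U: "U \<in> states N p" "rate U \<in> states N p"
    and cons: "total_integral N X p b (rate U) = 0"
  shows "conservative_step N X p b U (filtered_euler p b s \<epsilon> \<Delta>t rate U)"
proof -
  have "ref_integral (poly_of p b (filtered_euler p b s \<epsilon> \<Delta>t rate U i))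
      = ref_integral (poly_of p b (U i)) + \<Delta>t * ref_integral (poly_of p b (rate U i))" if "i < N" for i
  proof -
    have ui: "U i \<in> carrier_vec (Suc p)" "rate U i \<in> carrier_vec (Suc p)"
      using U that by (auto simp: states_def)
    then have "euler \<Delta>t (U i) (rate U i) \<in> carrier_vec (Suc p)" by (simp add: euler_def)
    then show ?thesis
      by (simp add: filtered_euler_def ref_integral_filter[OF b _ \<open>s \<ge> 1\<close>] poly_of_euler[OF ui]
          ref_integral_add ref_integral_smult)
  qed
  then have "total_integral N X p b (filtered_euler p b s \<epsilon> \<Delta>t rate U)
      = total_integral N X p b U + \<Delta>t * total_integral N X p b (rate U)"
    by (simp add: total_integral_def distrib_left sum.distrib sum_distrib_left mult.left_commute)
  with cons show ?thesis by (simp add: conservative_step_def)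
qed

lemma stable_step_total_sqnorm:
  assumes "mesh N X" "stable_semidiscretisation g N X p b M rate" "U \<in> states N p" "\<Delta>t > 0"
    and "stable_step N M \<Delta>t rate U U'"
  shows "total_sqnorm N X M U' \<le> total_sqnorm N X M U"
proof -
  have "total_sqnorm N X M U'
      \<le> (\<Sum>i<N. jac X i * (sqnorm_M M (U i) + 2 * \<Delta>t * inner_M M (U i) (rate U i)))"
    unfolding total_sqnorm_def using assms(1,5) jac_pos
    by (intro sum_mono mult_left_mono) (auto simp: stable_step_def less_imp_le)
  also have "\<dots> = total_sqnorm N X M U
      + 2 * \<Delta>t * (\<Sum>i<N. jac X i * inner_M M (U i) (rate U i))"
    by (simp add: total_sqnorm_def distrib_left sum.distrib sum_distrib_left mult_ac)
  also have "\<dots> \<le> total_sqnorm N X M U"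
    using stable_semidiscretisation_dissipative[OF assms(2,3)] assms(1,4)
    by (simp add: mesh_def mult_nonneg_nonpos)
  finally show ?thesis .
qed

theorem lemma3p3:
  fixes f :: "real \<Rightarrow> real" and g :: "real \<Rightarrow> real \<Rightarrow> real"
    and N p s :: nat and X :: "nat \<Rightarrow> real"
    and b :: "nat \<Rightarrow> real poly" and S :: "real poly \<Rightarrow> real poly \<Rightarrow> real"
    and M :: "real mat" and rate :: "state \<Rightarrow> state"
  assumes "mesh N X"
    and "admissible_basis p b"
    and "admissible_product p S"
    and "M = mass_matrix p b S"
    and "s \<ge> 1"
    and "semidiscretisation f g N p b rate"
    and "conservative_semidiscretisation N X p b rate"
    and "stable_semidiscretisation g N X p b M rate"
  shows
    \<comment> \<open>the condition on every element yields a conservative and stable scheme\<close>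
    "(\<forall>U\<in>states N p. \<forall>\<Delta>t>0. \<forall>\<epsilon>. (\<forall>i<N. \<epsilon> i \<ge> 0) \<longrightarrow>
        (\<forall>i<N. filter_condition p b M s (\<epsilon> i) \<Delta>t (U i) (rate U i)) \<longrightarrow>
        conservative_step N X p b U (filtered_euler p b s \<epsilon> \<Delta>t rate U) \<and>
        stable_step N M \<Delta>t rate U (filtered_euler p b s \<epsilon> \<Delta>t rate U) \<and>
        total_sqnorm N X M (filtered_euler p b s \<epsilon> \<Delta>t rate U) \<le> total_sqnorm N X M U) \<and>
    \<comment> \<open>vanishing rate of change on the element\<close>
     (\<forall>u\<in>carrier_vec (Suc p). \<forall>\<Delta>t>0. \<exists>\<epsilon>\<ge>0.
        filter_condition p b M s \<epsilon> \<Delta>t u (0\<^sub>v (Suc p))) \<and>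
    \<comment> \<open>non-constant intermediate value \<open>w\<close>, threshold for the time step in terms of \<open>w\<close> and \<open>dudt\<close>\<close>
     (\<forall>w\<in>carrier_vec (Suc p). \<forall>dudt\<in>carrier_vec (Suc p). \<not> constant_on_element p b w \<longrightarrow>
        (\<exists>\<delta>>0. \<forall>\<Delta>t. 0 < \<Delta>t \<and> \<Delta>t < \<delta> \<longrightarrow>
           (\<forall>u\<in>carrier_vec (Suc p). euler \<Delta>t u dudt = w \<longrightarrow>
              (\<exists>\<epsilon>\<ge>0. filter_condition p b M s \<epsilon> \<Delta>t u dudt)))) \<and>
    \<comment> \<open>fixed state \<open>u\<close>, so that the intermediate values remain non-constant as \<open>\<Delta>t\<close> tends to 0\<close>
     (\<forall>u\<in>carrier_vec (Suc p). \<forall>dudt\<in>carrier_vec (Suc p). \<not> constant_on_element p b u \<longrightarrow>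
        (\<exists>\<delta>>0. \<forall>\<Delta>t. 0 < \<Delta>t \<and> \<Delta>t < \<delta> \<longrightarrow>
           \<not> constant_on_element p b (euler \<Delta>t u dudt) \<and>
           (\<exists>\<epsilon>\<ge>0. filter_condition p b M s \<epsilon> \<Delta>t u dudt)))"
proof -
  have b: "poly_basis p b" by (rule admissible_basis_poly_basis[OF assms(2)])
  interpret element_product p S by (rule admissible_product_element_product[OF assms(3)])
  note M = assms(4)
  have rate: "rate U \<in> states N p" if "U \<in> states N p" for U
    using assms(6) that by (simp add: semidiscretisation_def)

  have scheme: "conservative_step N X p b U (filtered_euler p b s \<epsilon> \<Delta>t rate U) \<and>
      stable_step N M \<Delta>t rate U (filtered_euler p b s \<epsilon> \<Delta>t rate U) \<and>
      total_sqnorm N X M (filtered_euler p b s \<epsilon> \<Delta>t rate U) \<le> total_sqnorm N X M U"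
    if U: "U \<in> states N p" and t: "\<Delta>t > 0"
      and cond: "\<forall>i<N. filter_condition p b M s (\<epsilon> i) \<Delta>t (U i) (rate U i)" for U \<Delta>t \<epsilon>
  proof -
    have stable: "stable_step N M \<Delta>t rate U (filtered_euler p b s \<epsilon> \<Delta>t rate U)"
      using cond by (simp add: stable_step_def filtered_euler_def filter_condition_def)
    moreover have "total_integral N X p b (rate U) = 0"
      using assms(7) U by (simp add: conservative_semidiscretisation_def)
    ultimately show ?thesis
      using filtered_euler_conservative[where rate = rate, OF b assms(5) U rate[OF U]]
        stable_step_total_sqnorm[OF assms(1,8) U t] by blast
  qed

  \<comment> \<open>Without a rate of change there is no excess to remove, so the strength 0
    serves.\<close>
  have zero_rate: "\<exists>\<epsilon>\<ge>0. filter_condition p b M s \<epsilon> \<Delta>t u (0\<^sub>v (Suc p))"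
    if u: "u \<in> carrier_vec (Suc p)" for u \<Delta>t
  proof (intro exI[of _ 0] conjI)
    have "poly_of p b (0\<^sub>v (Suc p)) = 0" by (simp add: poly_of_def)
    moreover have "euler \<Delta>t u (0\<^sub>v (Suc p)) \<in> carrier_vec (Suc p)" using u by (simp add: euler_def)
    ultimately show "filter_condition p b M s 0 \<Delta>t u (0\<^sub>v (Suc p))"
      unfolding M by (simp add: filter_condition_iff[OF b u] poly_of_filter_0[OF b] zero_left)
  qed simp

  have fluct_pos: "0 < fluctuation (poly_of p b w)" if "\<not> constant_on_element p b w" for w
    using that by (intro fluctuation_pos degree_poly_of[OF b]) (simp add: constant_on_element_def)

  \<comment> \<open>For a prescribed intermediate value \<open>w\<close> its fluctuation is a fixed
    positive number, while the Euler excess tends to 0. The threshold therefore depends on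
    \<open>w\<close> and \<open>d\<close> only and precedes \<open>u\<close>.\<close>
  have fixed_value: "\<exists>\<delta>>0. \<forall>\<Delta>t. 0 < \<Delta>t \<and> \<Delta>t < \<delta> \<longrightarrow>
      (\<forall>u\<in>carrier_vec (Suc p). euler \<Delta>t u d = w \<longrightarrow> (\<exists>\<epsilon>\<ge>0. filter_condition p b M s \<epsilon> \<Delta>t u d))"
    if d: "d \<in> carrier_vec (Suc p)" and w: "\<not> constant_on_element p b w" for w d
  proof -
    let ?D = "S (poly_of p b d) (poly_of p b d)"
    have "((\<lambda>t. t\<^sup>2 * ?D) \<longlongrightarrow> 0\<^sup>2 * ?D) (at_right 0)" by (intro tendsto_intros)
    then have "((\<lambda>t. t\<^sup>2 * ?D) \<longlongrightarrow> 0) (at_right 0)" by simp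
    then have "\<forall>\<^sub>F t in at_right 0. t\<^sup>2 * ?D < fluctuation (poly_of p b w)"
      using fluct_pos[OF w] by (rule order_tendstoD)
    then obtain \<delta> where "\<delta> > 0" "\<And>t. 0 < t \<Longrightarrow> t < \<delta> \<Longrightarrow> t\<^sup>2 * ?D < fluctuation (poly_of p b w)"
      by (auto simp: eventually_at_right_field)
    then show ?thesis
      unfolding M using ex_filter_condition[OF b _ d _ assms(5)] by (intro exI[of _ \<delta>]) auto
  qed

  have fixed_state: "\<exists>\<delta>>0. \<forall>\<Delta>t. 0 < \<Delta>t \<and> \<Delta>t < \<delta> \<longrightarrow>
      \<not> constant_on_element p b (euler \<Delta>t u d) \<and> (\<exists>\<epsilon>\<ge>0. filter_condition p b M s \<epsilon> \<Delta>t u d)"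
    if u: "u \<in> carrier_vec (Suc p)" and d: "d \<in> carrier_vec (Suc p)"
      and nonconst: "\<not> constant_on_element p b u" for u d
  proof -
    let ?q = "poly_of p b u" and ?r = "poly_of p b d"
    \<comment> \<open>\<open>h t\<close> is the fluctuation of the intermediate value minus the
      Euler excess, written as a polynomial in \<open>t\<close> with \<open>h 0\<close> the
      fluctuation of \<open>u\<close>. Its positivity for small \<open>t\<close> yields both
      non-constancy and a suitable strength.\<close>
    define h where "h = (\<lambda>t. S ?q ?q + 2 * t * S ?q ?r + t\<^sup>2 * S ?r ?r
      - (ref_integral ?q + t * ref_integral ?r)\<^sup>2 / 2 - t\<^sup>2 * S ?r ?r)"
    have h: "fluctuation (poly_of p b (euler t u d)) = h t + t\<^sup>2 * S ?r ?r" for t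
      by (simp add: h_def fluctuation_def poly_of_euler[OF u d] square_add_smult ref_integral_add
          ref_integral_smult)
    have "(h \<longlongrightarrow> h 0) (at_right 0)"
      unfolding h_def by (intro tendsto_intros) auto
    moreover have "0 < h 0" using fluct_pos[OF nonconst] by (simp add: h_def fluctuation_def)
    ultimately have "\<forall>\<^sub>F t in at_right 0. 0 < h t" by (rule order_tendstoD)
    then obtain \<delta> where \<delta>: "\<delta> > 0" "\<And>t. 0 < t \<Longrightarrow> t < \<delta> \<Longrightarrow> 0 < h t"
      by (auto simp: eventually_at_right_field)
    have "\<not> constant_on_element p b (euler t u d) \<and> (\<exists>\<epsilon>\<ge>0. filter_condition p b M s \<epsilon> t u d)"
      if t: "0 < t \<and> t < \<delta>" for t
    proof
      have ht: "0 < h t" using \<delta>(2) t by blast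
      have "0 \<le> t\<^sup>2 * S ?r ?r" by (simp add: nonneg degree_poly_of[OF b])
      then have "0 < fluctuation (poly_of p b (euler t u d))" using h[of t] ht by linarith
      then show "\<not> constant_on_element p b (euler t u d)"
        by (auto simp: constant_on_element_def fluctuation_const)
      show "\<exists>\<epsilon>\<ge>0. filter_condition p b M s \<epsilon> t u d"
        unfolding M using t ht h[of t] by (intro ex_filter_condition[OF b u d _ assms(5)]) auto
    qed
    with \<delta>(1) show ?thesis by blast
  qed

  show ?thesis
    using scheme zero_rate fixed_value fixed_state by blast
qed

end
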